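(* Let $X$ be a (Tychonoff) cosmic space. The following assertions are equivalent: (1) $C_p(X)$ is strongly sequentially separable; (2) $C_p(X)$ is hereditarily $F$-separable; (3) $C_p(X)$ is hereditarily $\sigma$-separable; (4) $C_p(X)$ is Fréchet--Urysohn; (5) $X$ is a $\gamma$-space.
   Context: $C_p(X)$ denotes the set of all continuous real-valued functions on $X$ with the topology of pointwise convergence. "Countable" means at most countable. A network in a space $X$ is a family of subsets of $X$ such that every open set of $X$ is the union of some subfamily of it; a space is cosmic if it has a countable network. A space has a property hereditarily if every subspace (with the subspace topology) has that property. For a topological space $Z$ and $A\subseteq Z$, $[A]$ denotes the closure of $A$ in $Z$, and the sequential closure $[A]_s$ is the set of all limits in $Z$ of sequences of points of $A$. A space $Z$ is strongly sequentially separable if it is separable and every countable dense set $A\subseteq Z$ satisfies $[A]_s=Z$. A space $Z$ is Fréchet--Urysohn if for every $A\subseteq Z$ and $x\in[A]$ there is a sequence in $A$ converging to $x$. The $\sigma$-closure $[A]_\sigma$ of $A\subseteq Z$ is the set of all points $x\in Z$ such that (a) $x\in[A]_s$; and (b) whenever a sequence $\langle x_n\rangle_{n\in\mathbb N}$ of points of $A$ converges to $x$ and $x\in[A\setminus\{x_n:n\in\mathbb N\}]$, there exists a sequence $\langle y_n\rangle_{n\in\mathbb N}$ of points of $A\setminus\{x_n:n\in\mathbb N\}$ converging to $x$. A space $Z$ is $\sigma$-separable if there is a countable $A\subseteq Z$ with $Z=[A]_\sigma$. The $F$-closure $[A]_F$ of $A\subseteq Z$ is the set of all points $x\in[A]$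 such that for every $A'\subseteq A$ with $x\in[A']$ there exists a sequence of points of $A'$ converging to $x$. A space $Z$ is $F$-separable if there is a countable $A\subseteq Z$ with $Z=[A]_F$. A cover of a space $X$ is a family of proper subsets of $X$ whose union is $X$; it is open if its members are open. An $\omega$-cover is a cover such that each finite subset of $X$ is contained in some member of the cover. A $\gamma$-cover is an infinite cover such that each point of $X$ belongs to all but finitely many members of the cover. $X$ is a $\gamma$-space if every open $\omega$-cover of $X$ has a subfamily that is an open $\gamma$-cover of $X$. *)

theory Defs
  imports "HOL-Analysis.Analysis"
begin

definition tychonoff_space :: "'a topology \<Rightarrow> bool"
  where "tychonoff_space X \<longleftrightarrow> t1_space X \<and> completely_regular_space X"

definition network_in :: "'a topology \<Rightarrow> 'a set set \<Rightarrow> bool"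
  where "network_in X \<N> \<longleftrightarrow>
    (\<forall>N\<in>\<N>. N \<subseteq> topspace X) \<and> (\<forall>U. openin X U \<longrightarrow> (\<exists>\<N>'\<subseteq>\<N>. U = \<Union>\<N>'))"

definition cosmic_space :: "'a topology \<Rightarrow> bool"
  where "cosmic_space X \<longleftrightarrow> (\<exists>\<N>. countable \<N> \<and> network_in X \<N>)"

text \<open>A point of the product of \<open>topspace X\<close> many real lines is a function that is
  \<^const>\<open>undefined\<close> outside \<open>topspace X\<close>, so each continuous real-valued function on
  \<open>X\<close> is represented exactly once.\<close>

definition Cp :: "'a topology \<Rightarrow> ('a \<Rightarrow> real) topology"
  where "Cp X = subtopology (powertop_real (topspace X)) {f. continuous_map X euclideanreal f}"

text \<open>In the three closure operators below \<open>A\<close> is meant to be a subset of \<open>topspace Z\<close>;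
  \<^const>\<open>limitin\<close> places the limit, but not the terms of the sequence, in the space.\<close>

definition seq_closure_of :: "'a topology \<Rightarrow> 'a set \<Rightarrow> 'a set"  (infixr \<open>seq'_closure'_of\<close> 80)
  where "Z seq_closure_of A = {x. \<exists>s. range s \<subseteq> A \<and> limitin Z s x sequentially}"

definition sigma_closure_of :: "'a topology \<Rightarrow> 'a set \<Rightarrow> 'a set"  (infixr \<open>sigma'_closure'_of\<close> 80)
  where "Z sigma_closure_of A =
    {x. x \<in> Z seq_closure_of A \<and>
        (\<forall>s :: nat \<Rightarrow> 'a. range s \<subseteq> A \<and> limitin Z s x sequentially \<and> x \<in> Z closure_of (A - range s) \<longrightarrow>
             (\<exists>t. range t \<subseteq> A - range s \<and> limitin Z t x sequentially))}"

definition F_closure_of :: "'a topology \<Rightarrow> 'a set \<Rightarrow> 'a set"  (infixr \<open>F'_closure'_of\<close> 80)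
  where "Z F_closure_of A =
    {x. x \<in> Z closure_of A \<and>
        (\<forall>A'. A' \<subseteq> A \<and> x \<in> Z closure_of A' \<longrightarrow>
             (\<exists>s. range s \<subseteq> A' \<and> limitin Z s x sequentially))}"

definition strongly_sequentially_separable :: "'a topology \<Rightarrow> bool"
  where "strongly_sequentially_separable Z \<longleftrightarrow>
    separable_space Z \<and>
    (\<forall>A. countable A \<and> A \<subseteq> topspace Z \<and> Z closure_of A = topspace Z \<longrightarrow>
         Z seq_closure_of A = topspace Z)"

definition sigma_separable :: "'a topology \<Rightarrow> bool"
  where "sigma_separable Z \<longleftrightarrow>
    (\<exists>A. countable A \<and> A \<subseteq> topspace Z \<and> Z sigma_closure_of A = topspace Z)"

definition F_separable :: "'a topology \<Rightarrow> bool"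
  where "F_separable Z \<longleftrightarrow>
    (\<exists>A. countable A \<and> A \<subseteq> topspace Z \<and> Z F_closure_of A = topspace Z)"

definition Frechet_Urysohn_space :: "'a topology \<Rightarrow> bool"
  where "Frechet_Urysohn_space Z \<longleftrightarrow>
    (\<forall>A x. A \<subseteq> topspace Z \<and> x \<in> Z closure_of A \<longrightarrow>
         (\<exists>s. range s \<subseteq> A \<and> limitin Z s x sequentially))"

definition cover_of :: "'a topology \<Rightarrow> 'a set set \<Rightarrow> bool"
  where "cover_of X \<U> \<longleftrightarrow> (\<forall>U\<in>\<U>. U \<subset> topspace X) \<and> \<Union>\<U> = topspace X"

definition open_family :: "'a topology \<Rightarrow> 'a set set \<Rightarrow> bool"
  where "open_family X \<U> \<longleftrightarrow> (\<forall>U\<in>\<U>. openin X U)"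

definition omega_cover :: "'a topology \<Rightarrow> 'a set set \<Rightarrow> bool"
  where "omega_cover X \<U> \<longleftrightarrow>
    cover_of X \<U> \<and> (\<forall>K. finite K \<and> K \<subseteq> topspace X \<longrightarrow> (\<exists>U\<in>\<U>. K \<subseteq> U))"

definition gamma_cover :: "'a topology \<Rightarrow> 'a set set \<Rightarrow> bool"
  where "gamma_cover X \<U> \<longleftrightarrow>
    cover_of X \<U> \<and> infinite \<U> \<and> (\<forall>x\<in>topspace X. finite {U \<in> \<U>. x \<notin> U})"

definition gamma_space :: "'a topology \<Rightarrow> bool"
  where "gamma_space X \<longleftrightarrow>
    (\<forall>\<U>. open_family X \<U> \<and> omega_cover X \<U> \<longrightarrow>
         (\<exists>\<V>\<subseteq>\<U>. open_family X \<V> \<and> gamma_cover X \<V>))"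

end

theory Submission
  imports Defs
begin

text \<open>The implications run (1) \<open>\<Rightarrow>\<close> (5) \<open>\<Rightarrow>\<close> (4) \<open>\<Rightarrow>\<close> (2) \<open>\<Rightarrow>\<close> (3) \<open>\<Rightarrow>\<close> (4) \<open>\<Rightarrow>\<close> (1). A countable network of \<open>X\<close>
  induces one of \<open>C\<^sub>p(X)\<close>, so \<open>C\<^sub>p(X)\<close> is hereditarily separable; this gives (4) \<open>\<Rightarrow>\<close> (2) and
  (4) \<open>\<Rightarrow>\<close> (1).

  (1) \<open>\<Rightarrow>\<close> (5): for an open \<open>\<omega>\<close>-cover, the functions equal to 1 off some member are dense by
  complete regularity. A countable dense set of them contains a sequence converging to 0, and
  members of the cover off which its terms are 1 form a \<open>\<gamma>\<close>-cover.

  (5) \<open>\<Rightarrow>\<close> (4), after Gerlits and Nagy: if \<open>f\<close> is in the closure of \<open>A\<close> and \<open>p\<^sub>0, p\<^sub>1, \<dots>\<close> are distinct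
  points of \<open>X\<close>, the sets \<open>{x. \<bar>g x - f x\<bar> < 1 / (n + 1)} - {p\<^sub>n}\<close> with \<open>g \<in> A\<close> form an
  \<open>\<omega>\<close>-cover. Removing \<open>p\<^sub>n\<close> forces a \<open>\<gamma>\<close>-subcover to use each \<open>n\<close> only finitely often, so the
  corresponding functions \<open>g\<close> converge to \<open>f\<close>.

  (3) \<open>\<Rightarrow>\<close> (4): if \<open>x\<close> is in the closure of \<open>A\<close> but not in \<open>A\<close>, condition (b) of the \<open>\<sigma>\<close>-closure,
  applied in the subspace \<open>insert x A\<close> to the constant sequence \<open>x\<close>, gives a sequence in \<open>A\<close>.\<close>

section \<open>Points, convergence and neighbourhoods in \<open>Cp X\<close>\<close>

lemma topspace_Cp:
  "topspace (Cp X) = {f. f \<in> extensional (topspace X) \<and> continuous_map X euclideanreal f}"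
  by (auto simp: Cp_def PiE_def)

text \<open>Convergence in a subspace of a product is coordinatewise once the terms are eventually
  continuous and extensional. The assumption on \<open>s\<close> settles these side
  conditions.\<close>

lemma limitin_Cp:
  assumes "\<And>n. s n \<in> topspace (Cp X)"
  shows "limitin (Cp X) s f F \<longleftrightarrow>
    f \<in> topspace (Cp X) \<and> (\<forall>x\<in>topspace X. ((\<lambda>n. s n x) \<longlongrightarrow> f x) F)"
  using assms by (auto simp: Cp_def limitin_subtopology limitin_componentwise PiE_def)

lemma restrict_in_Cp:
  assumes "continuous_map X euclideanreal f"
  shows "restrict f (topspace X) \<in> topspace (Cp X)"
  using assms by (auto simp: topspace_Cp intro: continuous_map_eq)

lemma t1_space_Cp: "t1_space (Cp X)"
  unfolding Cp_def
  by (intro t1_space_subtopology Hausdorff_imp_t1_space)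
     (simp add: Hausdorff_space_product_topology)

lemma openin_Cp_coordinate:
  assumes "x \<in> topspace X" "open V"
  shows "openin (Cp X) {g \<in> topspace (Cp X). g x \<in> V}"
proof -
  have "continuous_map (Cp X) euclideanreal (\<lambda>g. g x)"
    unfolding Cp_def using assms(1)
    by (intro continuous_map_from_subtopology continuous_map_product_projection)
  then show ?thesis
    using assms(2) by (simp add: openin_continuous_map_preimage)
qed

lemma openin_Cp_ball:
  assumes "finite K" "K \<subseteq> topspace X"
  shows "openin (Cp X) {g \<in> topspace (Cp X). \<forall>x\<in>K. \<bar>g x - f x\<bar> < e}"
  using assms
proof (induction K rule: finite_induct)
  case empty
  then show ?case by simp
next
  case (insert y K)
  have "{g \<in> topspace (Cp X). \<forall>x\<in>insert y K. \<bar>g x - f x\<bar> < e} =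
    {g \<in> topspace (Cp X). g y \<in> ball (f y) e} \<inter> {g \<in> topspace (Cp X). \<forall>x\<in>K. \<bar>g x - f x\<bar> < e}"
    by (auto simp: dist_real_def abs_minus_commute)
  with insert show ?case
    using openin_Cp_coordinate[of y X "ball (f y) e"] by auto
qed

text \<open>A basic open box restricts only finitely many coordinates. These form \<open>K\<close>,
  and the least of their finitely many radii serves as \<open>e\<close>.\<close>

lemma openin_Cp_contains_ball:
  assumes "openin (Cp X) U" "f \<in> U"
  obtains K e where "finite K" "K \<subseteq> topspace X" "e > 0"
    "\<And>g. g \<in> topspace (Cp X) \<Longrightarrow> (\<And>x. x \<in> K \<Longrightarrow> \<bar>g x - f x\<bar> < e) \<Longrightarrow> g \<in> U"
proof -
  obtain T where T: "openin (powertop_real (topspace X)) T"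
      "U = T \<inter> {f. continuous_map X euclideanreal f}"
    using assms(1) by (auto simp: Cp_def openin_subtopology)
  have "f \<in> T" using assms T by auto
  then obtain V where V: "finite {i \<in> topspace X. V i \<noteq> UNIV}"
      "\<forall>i\<in>topspace X. open (V i)" "f \<in> Pi\<^sub>E (topspace X) V" "Pi\<^sub>E (topspace X) V \<subseteq> T"
    using T(1) unfolding openin_product_topology_alt by force
  define K where "K = {i \<in> topspace X. V i \<noteq> UNIV}"
  have "\<forall>x\<in>K. \<exists>e>0. ball (f x) e \<subseteq> V x"
    using V(2,3) by (auto simp: K_def intro!: open_contains_ball_eq[THEN iffD1, rule_format])
  then obtain r where r: "\<And>x. x \<in> K \<Longrightarrow> r x > (0::real)" "\<And>x. x \<in> K \<Longrightarrow> ball (f x) (r x) \<subseteq> V x"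
    by metis
  \<comment> \<open>The extra element 1 keeps the minimum meaningful when \<open>K\<close> is
    empty.\<close>
  define e where "e = Min (insert 1 (r ` K))"
  have fin: "finite K" using V(1) by (simp add: K_def)
  show ?thesis
  proof
    show "finite K" by fact
    show "K \<subseteq> topspace X" by (auto simp: K_def)
    show "e > 0" using fin r by (auto simp: e_def)
    fix g assume g: "g \<in> topspace (Cp X)" "\<And>x. x \<in> K \<Longrightarrow> \<bar>g x - f x\<bar> < e"
    have "g x \<in> V x" if "x \<in> topspace X" for x
    proof (cases "x \<in> K")
      case True
      then have "e \<le> r x" using fin by (auto simp: e_def)
      with g(2)[OF True] have "g x \<in> ball (f x) (r x)"
        by (simp add: dist_real_def abs_minus_commute)
      with r(2)[OF True] show ?thesis by auto
    next
      case False
      with that show ?thesis by (auto simp: K_def)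
    qed
    with g(1) V(4) have "g \<in> T" by (auto simp: topspace_Cp PiE_def)
    with g(1) T(2) show "g \<in> U" by (auto simp: topspace_Cp)
  qed
qed

lemma closure_of_Cp_approximation:
  assumes "f \<in> (Cp X) closure_of A" "finite K" "K \<subseteq> topspace X" "e > 0"
  obtains g where "g \<in> A" "g \<in> topspace (Cp X)" "\<And>x. x \<in> K \<Longrightarrow> \<bar>g x - f x\<bar> < e"
proof -
  define V where "V = {g \<in> topspace (Cp X). \<forall>x\<in>K. \<bar>g x - f x\<bar> < e}"
  have "f \<in> V"
    using assms by (auto simp: V_def in_closure_of)
  moreover have "openin (Cp X) V"
    unfolding V_def using assms(2,3) by (rule openin_Cp_ball)
  ultimately obtain g where "g \<in> A" "g \<in> V"
    using assms(1) unfolding in_closure_of by blast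
  then show ?thesis by (intro that) (auto simp: V_def)
qed

section \<open>Networks and cosmic spaces\<close>

lemma network_in_obtain:
  assumes "network_in X \<N>" "openin X U" "x \<in> U"
  obtains N where "N \<in> \<N>" "x \<in> N" "N \<subseteq> U"
proof -
  obtain \<N>' where "\<N>' \<subseteq> \<N>" "U = \<Union>\<N>'"
    using assms(1,2) unfolding network_in_def by blast
  with assms(3) that show ?thesis by blast
qed

lemma network_inI:
  assumes "\<And>N. N \<in> \<N> \<Longrightarrow> N \<subseteq> topspace X"
    and "\<And>U x. openin X U \<Longrightarrow> x \<in> U \<Longrightarrow> \<exists>N\<in>\<N>. x \<in> N \<and> N \<subseteq> U"
  shows "network_in X \<N>"
  unfolding network_in_def
proof (intro conjI allI impI ballI)
  fix U assume "openin X U"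
  then have "U = \<Union>{N \<in> \<N>. N \<subseteq> U}" using assms(2) by blast
  then show "\<exists>\<N>'\<subseteq>\<N>. U = \<Union>\<N>'" by (intro exI[of _ "{N \<in> \<N>. N \<subseteq> U}"]) auto
qed (use assms(1) in blast)

lemma cosmic_space_subtopology:
  assumes "cosmic_space X"
  shows "cosmic_space (subtopology X S)"
proof -
  obtain \<N> where \<N>: "countable \<N>" "network_in X \<N>"
    using assms by (auto simp: cosmic_space_def)
  have "network_in (subtopology X S) ((\<lambda>N. N \<inter> S) ` \<N>)"
  proof (rule network_inI)
    show "N \<subseteq> topspace (subtopology X S)" if "N \<in> (\<lambda>N. N \<inter> S) ` \<N>" for N
      using that \<N>(2) by (auto simp: network_in_def)
    fix U x assume "openin (subtopology X S) U" "x \<in> U"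
    then obtain T where T: "openin X T" "U = T \<inter> S" "x \<in> T" "x \<in> S"
      by (auto simp: openin_subtopology)
    obtain N where "N \<in> \<N>" "x \<in> N" "N \<subseteq> T"
      using \<N>(2) T(1,3) by (rule network_in_obtain)
    with T show "\<exists>N\<in>(\<lambda>N. N \<inter> S) ` \<N>. x \<in> N \<and> N \<subseteq> U"
      by (intro bexI[of _ "N \<inter> S"]) auto
  qed
  with \<N>(1) show ?thesis unfolding cosmic_space_def by blast
qed

text \<open>One point chosen from each nonempty network member gives a countable dense set.\<close>

lemma cosmic_imp_separable_space:
  assumes "cosmic_space X"
  shows "separable_space X"
proof -
  obtain \<N> where \<N>: "countable \<N>" "network_in X \<N>"
    using assms by (auto simp: cosmic_space_def)
  define C where "C = (\<lambda>N. SOME x. x \<in> N) ` (\<N> - {{}})"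
  have C: "(SOME x. x \<in> N) \<in> N" if "N \<in> \<N> - {{}}" for N
    using that by (simp add: some_in_eq)
  have "x \<in> X closure_of C" if "x \<in> topspace X" for x
    unfolding in_closure_of
  proof (intro conjI allI impI that)
    fix T assume "x \<in> T \<and> openin X T"
    then obtain N where "N \<in> \<N>" "x \<in> N" "N \<subseteq> T" using \<N>(2) network_in_obtain by metis
    with C show "\<exists>y. y \<in> C \<and> y \<in> T" by (auto simp: C_def)
  qed
  moreover have "countable C" using \<N>(1) by (simp add: C_def)
  moreover have "C \<subseteq> topspace X" using C \<N>(2) by (auto simp: C_def network_in_def)
  ultimately show ?thesis
    unfolding separable_space_def by (meson closure_of_subset_topspace subsetI subset_antisym)
qed

text \<open>The network consists of the sets of functions sending finitely many members of
  \<open>\<N>\<close> into prescribed basic open sets of reals. There are countably many such finite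
  prescriptions. The sets themselves need not be open.\<close>

lemma cosmic_space_Cp:
  assumes "cosmic_space X"
  shows "cosmic_space (Cp X)"
proof -
  obtain \<N> where \<N>: "countable \<N>" "network_in X \<N>"
    using assms by (auto simp: cosmic_space_def)
  obtain \<B> :: "real set set" where \<B>: "countable \<B>" "topological_basis \<B>"
    using ex_countable_basis by blast
  define box where "box F = {g \<in> topspace (Cp X). \<forall>(N, B)\<in>F. g ` N \<subseteq> B}"
    for F :: "('a set \<times> real set) set"
  define \<M> where "\<M> = box ` {F. finite F \<and> F \<subseteq> \<N> \<times> \<B>}"
  have "network_in (Cp X) \<M>"
  proof (rule network_inI)
    show "M \<subseteq> topspace (Cp X)" if "M \<in> \<M>" for M
      using that by (auto simp: \<M>_def box_def)
    fix U f assume U: "openin (Cp X) U" "f \<in> U"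
    obtain K e where K: "finite K" "K \<subseteq> topspace X" "e > 0"
      and KU: "\<And>g. g \<in> topspace (Cp X) \<Longrightarrow> (\<And>x. x \<in> K \<Longrightarrow> \<bar>g x - f x\<bar> < e) \<Longrightarrow> g \<in> U"
      using openin_Cp_contains_ball[OF U] by metis
    have f: "f \<in> topspace (Cp X)" using U openin_subset by blast
    \<comment> \<open>Continuity of \<open>f\<close> makes the preimage of \<open>B\<close> open, so
      some network member around \<open>x\<close> lies inside it.\<close>
    have "\<exists>N B. N \<in> \<N> \<and> B \<in> \<B> \<and> x \<in> N \<and> f ` N \<subseteq> B \<and> B \<subseteq> ball (f x) e" if "x \<in> K" for x
    proof -
      obtain B where B: "B \<in> \<B>" "f x \<in> B" "B \<subseteq> ball (f x) e"
        using topological_basisE[OF \<B>(2), of "ball (f x) e" "f x"] K(3) by auto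
      have "openin X {y \<in> topspace X. f y \<in> B}"
        using f topological_basis_open[OF \<B>(2) B(1)]
        by (auto simp: topspace_Cp intro!: openin_continuous_map_preimage)
      moreover have "x \<in> {y \<in> topspace X. f y \<in> B}" using that K B by auto
      ultimately obtain N where "N \<in> \<N>" "x \<in> N" "N \<subseteq> {y \<in> topspace X. f y \<in> B}"
        by (rule network_in_obtain[OF \<N>(2)])
      with B show ?thesis by blast
    qed
    then obtain N B where NB: "\<And>x. x \<in> K \<Longrightarrow>
        N x \<in> \<N> \<and> B x \<in> \<B> \<and> x \<in> N x \<and> f ` N x \<subseteq> B x \<and> B x \<subseteq> ball (f x) e"
      by metis
    define F where "F = (\<lambda>x. (N x, B x)) ` K"
    have "box F \<in> \<M>" using K(1) NB by (auto simp: \<M>_def F_def)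
    moreover have "f \<in> box F" using f NB by (auto simp: box_def F_def)
    moreover have "box F \<subseteq> U"
    proof
      fix g assume g: "g \<in> box F"
      have "\<bar>g x - f x\<bar> < e" if "x \<in> K" for x
      proof -
        have "g ` N x \<subseteq> B x" using g that by (auto simp: box_def F_def)
        then have "g x \<in> ball (f x) e" using NB[OF that] by blast
        then show ?thesis by (simp add: dist_real_def abs_minus_commute)
      qed
      with g show "g \<in> U" by (intro KU) (auto simp: box_def)
    qed
    ultimately show "\<exists>M\<in>\<M>. f \<in> M \<and> M \<subseteq> U" by blast
  qed
  moreover have "countable \<M>"
    using \<N>(1) \<B>(1) by (simp add: \<M>_def countable_Collect_finite_subset)
  ultimately show ?thesis unfolding cosmic_space_def by blast
qed

section \<open>From strong sequential separability to the \<gamma>-property\<close>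

text \<open>This makes the functions equal to 1 off some member of an \<omega>-cover dense: any
  \<open>g\<close> can be matched on a finite subset of a member.\<close>

lemma Cp_interpolation:
  assumes "tychonoff_space X" "openin X U" "finite K" "K \<subseteq> U" "g \<in> topspace (Cp X)"
  obtains f where "f \<in> topspace (Cp X)" "\<And>x. x \<in> K \<Longrightarrow> f x = g x"
    "\<And>x. x \<in> topspace X - U \<Longrightarrow> f x = 1"
proof -
  have "compactin X K"
    using assms by (intro finite_imp_compactin) (auto dest: openin_subset)
  have "completely_regular_space X" using assms(1) by (simp add: tychonoff_space_def)
  moreover note \<open>compactin X K\<close>
  moreover have "closedin X (topspace X - U)" using assms(2) by (simp add: closedin_diff)
  moreover have "disjnt K (topspace X - U)" using assms(4) by (auto simp: disjnt_def)
  ultimately obtain h where h: "continuous_map X euclideanreal h" "h ` K \<subseteq> {0}" "h ` (topspace X - U) \<subseteq> {1}"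
    by (rule Urysohn_completely_regular_compact_closed_alt[of X K "topspace X - U" 1 0])
  \<comment> \<open>Blend of the constant 1 and \<open>g\<close> with weight \<open>h\<close>: it is
    \<open>g\<close> where \<open>h\<close> is 0 and 1 where \<open>h\<close> is 1.\<close>
  define f where "f = restrict (\<lambda>x. h x + (1 - h x) * g x) (topspace X)"
  have K: "K \<subseteq> topspace X" using assms openin_subset by blast
  show ?thesis
  proof
    show "f \<in> topspace (Cp X)"
      unfolding f_def using h(1) assms(5)
      by (intro restrict_in_Cp continuous_map_add continuous_map_real_mult continuous_map_diff)
        (auto simp: topspace_Cp)
    show "f x = g x" if "x \<in> K" for x
    proof -
      have "h x = 0" using h(2) that by auto
      then show ?thesis using K that by (auto simp: f_def)
    qed
    show "f x = 1" if "x \<in> topspace X - U" for x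
    proof -
      have "h x = 1" using h(3) that by blast
      then show ?thesis using that by (auto simp: f_def)
    qed
  qed
qed

lemma strongly_sequentially_separable_imp_gamma_space:
  assumes "tychonoff_space X" "cosmic_space X" "strongly_sequentially_separable (Cp X)"
  shows "gamma_space X"
  unfolding gamma_space_def
proof (intro allI impI, elim conjE)
  fix \<U> assume op: "open_family X \<U>" and om: "omega_cover X \<U>"
  have proper: "U \<subset> topspace X" if "U \<in> \<U>" for U
    using om that by (auto simp: omega_cover_def cover_of_def)
  define A where "A = {f \<in> topspace (Cp X). \<exists>U\<in>\<U>. \<forall>x\<in>topspace X - U. f x = 1}"
  have A: "A \<subseteq> topspace (Cp X)" by (auto simp: A_def)
  have dense_A: "(Cp X) closure_of A = topspace (Cp X)"
  proof -
    have "g \<in> (Cp X) closure_of A" if g: "g \<in> topspace (Cp X)" for g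
      unfolding in_closure_of
    proof (intro conjI allI impI g)
      fix T assume T: "g \<in> T \<and> openin (Cp X) T"
      obtain K e where K: "finite K" "K \<subseteq> topspace X" "e > 0"
        and KT: "\<And>h. h \<in> topspace (Cp X) \<Longrightarrow> (\<And>x. x \<in> K \<Longrightarrow> \<bar>h x - g x\<bar> < e) \<Longrightarrow> h \<in> T"
        using openin_Cp_contains_ball[of X T g] T by metis
      obtain U where U: "U \<in> \<U>" "K \<subseteq> U"
        using om K by (auto simp: omega_cover_def)
      have "openin X U" using op U by (auto simp: open_family_def)
      then obtain f where f: "f \<in> topspace (Cp X)" "\<And>x. x \<in> K \<Longrightarrow> f x = g x"
          "\<And>x. x \<in> topspace X - U \<Longrightarrow> f x = 1"
        using Cp_interpolation[OF assms(1) _ K(1) U(2) g] by metis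
      have "f \<in> A" using f U by (auto simp: A_def)
      moreover have "f \<in> T" using f K by (intro KT) auto
      ultimately show "\<exists>y. y \<in> A \<and> y \<in> T" by blast
    qed
    then show ?thesis by (meson closure_of_subset_topspace subsetI subset_antisym)
  qed
  \<comment> \<open>The hypothesis speaks of countable dense sets only, and \<open>A\<close> may be
    uncountable. A countable \<open>B\<close> dense in \<open>A\<close> is therefore dense in the
    whole space.\<close>
  have "separable_space (subtopology (Cp X) A)"
    using assms(2) by (simp add: cosmic_imp_separable_space cosmic_space_subtopology cosmic_space_Cp)
  then obtain B where B: "countable B" "B \<subseteq> A" "(subtopology (Cp X) A) closure_of B = A"
    using A by (auto simp: separable_space_def Int_absorb1)
  have "A \<subseteq> (Cp X) closure_of B"
    using B(3) closure_of_subtopology_subset by metis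
  then have "(Cp X) closure_of B = topspace (Cp X)"
    using dense_A by (metis closure_of_mono closure_of_closure_of closure_of_subset_topspace subset_antisym)
  then have "(Cp X) seq_closure_of B = topspace (Cp X)"
    using assms(3) A B unfolding strongly_sequentially_separable_def by blast
  moreover have "restrict (\<lambda>_. 0) (topspace X) \<in> topspace (Cp X)"
    by (intro restrict_in_Cp) auto
  ultimately obtain s where s: "range s \<subseteq> B" "limitin (Cp X) s (restrict (\<lambda>_. 0) (topspace X)) sequentially"
    unfolding seq_closure_of_def by blast
  have sA: "s n \<in> A" for n using s B by auto
  then have "\<forall>n. \<exists>U\<in>\<U>. \<forall>x\<in>topspace X - U. s n x = 1" by (auto simp: A_def)
  then obtain u where u: "\<And>n. u n \<in> \<U>" "\<And>n x. x \<in> topspace X - u n \<Longrightarrow> s n x = 1" by metis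
  \<comment> \<open>Off \<open>u n\<close> the value of \<open>s n\<close> is 1, while the values at
    \<open>x\<close> tend to 0, so \<open>x\<close> can lie outside \<open>u n\<close> for finitely
    many \<open>n\<close> only.\<close>
  have ev: "eventually (\<lambda>n. x \<in> u n) sequentially" if x: "x \<in> topspace X" for x
  proof -
    have "(\<lambda>n. s n x) \<longlonglongrightarrow> 0"
      using s(2) x sA A by (subst (asm) limitin_Cp) auto
    then have "eventually (\<lambda>n. s n x < 1) sequentially"
      by (rule order_tendstoD) auto
    then show ?thesis
      by (rule eventually_mono) (use u(2) x in force)
  qed
  have "open_family X (range u)" using op u(1) by (auto simp: open_family_def)
  moreover have "range u \<subseteq> \<U>" using u(1) by auto
  moreover have "gamma_cover X (range u)"
    unfolding gamma_cover_def cover_of_def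
  proof (intro conjI ballI)
    show "U \<subset> topspace X" if "U \<in> range u" for U using that u(1) proper by auto
    show "\<Union>(range u) = topspace X"
    proof
      show "\<Union>(range u) \<subseteq> topspace X" using u(1) proper by blast
      show "topspace X \<subseteq> \<Union>(range u)"
        using ev eventually_happens'[OF sequentially_bot] by blast
    qed
    \<comment> \<open>Otherwise one member recurs for infinitely many indices. Being proper, it
      misses a point, against \<open>ev\<close>.\<close>
    show "infinite (range u)"
    proof
      assume "finite (range u)"
      then obtain n where n: "infinite {m. u m = u n}"
        using pigeonhole_infinite[of UNIV u] by auto
      obtain x where "x \<in> topspace X" "x \<notin> u n" using proper[OF u(1)[of n]] by auto
      with ev have "finite {m. x \<notin> u m}"
        by (auto simp: eventually_cofinite simp flip: cofinite_eq_sequentially)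
      with \<open>x \<notin> u n\<close> n show False
        by (metis (mono_tags, lifting) Collect_mono finite_subset)
    qed
    fix x assume "x \<in> topspace X"
    then have "finite {m. x \<notin> u m}"
      using ev by (auto simp: eventually_cofinite simp flip: cofinite_eq_sequentially)
    moreover have "{U \<in> range u. x \<notin> U} = u ` {m. x \<notin> u m}" by auto
    ultimately show "finite {U \<in> range u. x \<notin> U}" by simp
  qed
  ultimately show "\<exists>\<V>\<subseteq>\<U>. open_family X \<V> \<and> gamma_cover X \<V>" by blast
qed

section \<open>From the \<gamma>-property to the Frechet-Urysohn property\<close>

lemma gamma_space_imp_Frechet_Urysohn_Cp:
  assumes "t1_space X" "gamma_space X"
  shows "Frechet_Urysohn_space (Cp X)"
  unfolding Frechet_Urysohn_space_def
proof (intro allI impI, elim conjE)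
  fix A f assume A: "A \<subseteq> topspace (Cp X)" and f: "f \<in> (Cp X) closure_of A"
  have inverse_Suc: "0 < inverse (real (Suc n))" for n by simp
  have ftop: "f \<in> topspace (Cp X)" using f by (simp add: in_closure_of)
  show "\<exists>s. range s \<subseteq> A \<and> limitin (Cp X) s f sequentially"
  proof (cases "finite (topspace X)")
    \<comment> \<open>With finitely many points there is no injective sequence \<open>p\<close>, but
      one approximation can control all points at once.\<close>
    case True
    have "\<exists>g\<in>A. \<forall>x\<in>topspace X. \<bar>g x - f x\<bar> < inverse (real (Suc n))" for n
      using closure_of_Cp_approximation[OF f True subset_refl inverse_Suc] by metis
    then obtain s where s: "\<And>n. s n \<in> A"
        "\<And>n x. x \<in> topspace X \<Longrightarrow> \<bar>s n x - f x\<bar> < inverse (real (Suc n))"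
      by metis
    have "(\<lambda>n. s n x) \<longlonglongrightarrow> f x" if "x \<in> topspace X" for x
      unfolding LIM_zero_iff[symmetric, of _ "f x"]
      by (rule Lim_null_comparison[OF _ LIMSEQ_inverse_real_of_nat])
         (use s(2)[OF that] in \<open>auto simp: less_imp_le\<close>)
    then have "limitin (Cp X) s f sequentially"
      using s(1) A ftop by (subst limitin_Cp) auto
    with s(1) show ?thesis by blast
  next
    case False
    then obtain p :: "nat \<Rightarrow> 'a" where p: "inj p" "range p \<subseteq> topspace X"
      using infinite_countable_subset by blast
    define W where "W n g = {x \<in> topspace X. \<bar>g x - f x\<bar> < inverse (real (Suc n))} - {p n}" for n g
    define \<U> where "\<U> = {W n g | n g. g \<in> A}"
    have W_open: "openin X (W n g)" if "g \<in> A" for n g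
    proof -
      have "continuous_map X euclideanreal (\<lambda>x. \<bar>g x - f x\<bar>)"
        using that A ftop by (intro continuous_map_real_abs continuous_map_diff)
          (auto simp: topspace_Cp)
      then have "openin X {x \<in> topspace X. \<bar>g x - f x\<bar> \<in> {..<inverse (real (Suc n))}}"
        by (rule openin_continuous_map_preimage) simp
      with assms(1) show ?thesis
        by (simp add: W_def t1_space_openin_delete_alt)
    qed
    have W_omega: "\<exists>U\<in>\<U>. K \<subseteq> U" if K: "finite K" "K \<subseteq> topspace X" for K
    proof -
      \<comment> \<open>The index must be chosen before \<open>g\<close>: the deleted point
        \<open>p n\<close> has to avoid \<open>K\<close>.\<close>
      have "infinite (range p)" using p(1) by (simp add: finite_image_iff)
      then obtain n where n: "p n \<notin> K" using K(1) finite_subset[of "range p" K] by blast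
      obtain g where "g \<in> A" "\<And>x. x \<in> K \<Longrightarrow> \<bar>g x - f x\<bar> < inverse (real (Suc n))"
        using closure_of_Cp_approximation[OF f K inverse_Suc] by metis
      with n K(2) show ?thesis by (auto simp: \<U>_def W_def)
    qed
    have "omega_cover X \<U>"
      unfolding omega_cover_def cover_of_def
    proof (intro conjI allI impI ballI)
      show "U \<subset> topspace X" if "U \<in> \<U>" for U
        using that p(2) by (auto simp: \<U>_def W_def)
      show "\<Union>\<U> = topspace X"
      proof
        show "\<Union>\<U> \<subseteq> topspace X" by (auto simp: \<U>_def W_def)
        show "topspace X \<subseteq> \<Union>\<U>"
        proof
          fix x assume "x \<in> topspace X"
          then show "x \<in> \<Union>\<U>" using W_omega[of "{x}"] by auto
        qed
      qed
    qed (use W_omega in blast)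
    moreover have "open_family X \<U>"
      using W_open by (auto simp: open_family_def \<U>_def)
    ultimately obtain \<V> where \<V>: "\<V> \<subseteq> \<U>" "gamma_cover X \<V>"
      using assms(2) unfolding gamma_space_def by blast
    then obtain v :: "nat \<Rightarrow> 'a set" where v: "inj v" "range v \<subseteq> \<V>"
      using infinite_countable_subset[of \<V>] by (auto simp: gamma_cover_def)
    have "v k \<in> \<U>" for k using v(2) \<V>(1) by blast
    then have "\<forall>k. \<exists>n g. g \<in> A \<and> v k = W n g" unfolding \<U>_def by blast
    then obtain n s where ns: "\<And>k. s k \<in> A" "\<And>k. v k = W (n k) (s k)" by metis
    have fin: "finite {k. x \<notin> v k}" if "x \<in> topspace X" for x
    proof -
      have "finite {U \<in> \<V>. x \<notin> U}" using \<V>(2) that by (simp add: gamma_cover_def)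
      then have "finite (v ` {k. x \<notin> v k})"
        by (rule finite_subset[rotated]) (use v in auto)
      then show ?thesis using v(1) by (metis finite_imageD inj_on_subset subset_UNIV)
    qed
    have "(\<lambda>k. s k x) \<longlonglongrightarrow> f x" if x: "x \<in> topspace X" for x
    proof (rule LIMSEQ_I)
      fix e :: real assume "e > 0"
      then obtain m where m: "inverse (real (Suc m)) < e" using reals_Archimedean by blast
      \<comment> \<open>Outside this finite set, \<open>v k\<close> contains \<open>x\<close> and
        each of \<open>p 0\<close>, ..., \<open>p m\<close>. As \<open>v k\<close> misses
        \<open>p (n k)\<close>, this forces \<open>m < n k\<close>.\<close>
      have "finite ({k. x \<notin> v k} \<union> (\<Union>j\<le>m. {k. p j \<notin> v k}))"
        using fin x p(2) by auto
      moreover have "\<bar>s k x - f x\<bar> < e" if "k \<notin> {k. x \<notin> v k} \<union> (\<Union>j\<le>m. {k. p j \<notin> v k})" for k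
      proof -
        have "p (n k) \<notin> v k" by (simp add: ns W_def)
        with that have "m < n k" by (auto simp: not_le)
        then have "inverse (real (Suc (n k))) < inverse (real (Suc m))" by simp
        moreover have "\<bar>s k x - f x\<bar> < inverse (real (Suc (n k)))"
          using that by (simp add: ns W_def)
        ultimately show ?thesis using m by linarith
      qed
      ultimately have "finite {k. \<not> \<bar>s k x - f x\<bar> < e}"
        by (metis (mono_tags, lifting) finite_subset mem_Collect_eq subsetI)
      then have "eventually (\<lambda>k. \<bar>s k x - f x\<bar> < e) sequentially"
        by (simp add: eventually_cofinite flip: cofinite_eq_sequentially)
      then show "\<exists>N. \<forall>k\<ge>N. norm (s k x - f x) < e"
        by (simp add: eventually_sequentially)
    qed
    then have "limitin (Cp X) s f sequentially"
      using ns(1) A ftop by (subst limitin_Cp) auto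
    with ns(1) show ?thesis by blast
  qed
qed

section \<open>Frechet-Urysohn, \<open>F\<close>- and \<sigma>-separable spaces\<close>

lemma Frechet_Urysohn_space_subtopology:
  assumes "Frechet_Urysohn_space Z"
  shows "Frechet_Urysohn_space (subtopology Z S)"
  unfolding Frechet_Urysohn_space_def
proof (intro allI impI, elim conjE)
  fix A x assume A: "A \<subseteq> topspace (subtopology Z S)" and x: "x \<in> (subtopology Z S) closure_of A"
  have "x \<in> Z closure_of A" "x \<in> S"
    using x closure_of_subtopology_subset[of Z S A] by (auto simp: closure_of_subtopology)
  then obtain s where "range s \<subseteq> A" "limitin Z s x sequentially"
    using assms A unfolding Frechet_Urysohn_space_def by (metis Int_subset_iff topspace_subtopology)
  with A \<open>x \<in> S\<close> show "\<exists>s. range s \<subseteq> A \<and> limitin (subtopology Z S) s x sequentially"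
    by (intro exI[of _ s]) (auto simp: limitin_subtopology intro!: always_eventually)
qed

text \<open>Any countable dense set is a witness, since the sequences are available for all of its
  subsets.\<close>

lemma Frechet_Urysohn_separable_imp_F_separable:
  assumes "Frechet_Urysohn_space Z" "separable_space Z"
  shows "F_separable Z"
proof -
  obtain A where A: "countable A" "A \<subseteq> topspace Z" "Z closure_of A = topspace Z"
    using assms(2) by (auto simp: separable_space_def)
  have "\<exists>s. range s \<subseteq> A' \<and> limitin Z s x sequentially" if "A' \<subseteq> A" "x \<in> Z closure_of A'" for A' x
    using assms(1) that A(2) unfolding Frechet_Urysohn_space_def by (meson subset_trans)
  then have "Z F_closure_of A = topspace Z"
    using A(3) unfolding F_closure_of_def by blast
  with A show ?thesis unfolding F_separable_def by blast
qed

lemma Frechet_Urysohn_separable_imp_strongly_sequentially_separable: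
  assumes "Frechet_Urysohn_space Z" "separable_space Z"
  shows "strongly_sequentially_separable Z"
  unfolding strongly_sequentially_separable_def
proof (intro conjI allI impI assms(2), elim conjE)
  fix A assume A: "A \<subseteq> topspace Z" "Z closure_of A = topspace Z"
  show "Z seq_closure_of A = topspace Z"
  proof
    show "Z seq_closure_of A \<subseteq> topspace Z"
      by (auto simp: seq_closure_of_def dest: limitin_topspace)
    show "topspace Z \<subseteq> Z seq_closure_of A"
      using assms(1) A unfolding Frechet_Urysohn_space_def seq_closure_of_def by blast
  qed
qed

text \<open>Taking \<open>A' = A\<close> gives the first condition of the \<sigma>-closure, and
  \<open>A' = A - range s\<close> the second.\<close>

lemma F_closure_of_subset_sigma_closure_of: "Z F_closure_of A \<subseteq> Z sigma_closure_of A"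
proof
  fix x assume x: "x \<in> Z F_closure_of A"
  then have *: "\<exists>s. range s \<subseteq> A' \<and> limitin Z s x sequentially"
    if "A' \<subseteq> A" "x \<in> Z closure_of A'" for A'
    using that by (auto simp: F_closure_of_def)
  have "x \<in> Z closure_of A" using x by (simp add: F_closure_of_def)
  then show "x \<in> Z sigma_closure_of A"
    using *[of A] *[OF Diff_subset] by (auto simp: sigma_closure_of_def seq_closure_of_def)
qed

lemma F_separable_imp_sigma_separable:
  assumes "F_separable Z"
  shows "sigma_separable Z"
proof -
  obtain A where A: "countable A" "A \<subseteq> topspace Z" "Z F_closure_of A = topspace Z"
    using assms by (auto simp: F_separable_def)
  have "Z sigma_closure_of A \<subseteq> topspace Z"
    by (auto simp: sigma_closure_of_def seq_closure_of_def dest: limitin_topspace)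
  with A show ?thesis
    using F_closure_of_subset_sigma_closure_of[of Z A] unfolding sigma_separable_def by blast
qed

lemma hereditarily_sigma_separable_imp_Frechet_Urysohn:
  assumes "t1_space Z" "hereditarily sigma_separable Z"
  shows "Frechet_Urysohn_space Z"
  unfolding Frechet_Urysohn_space_def
proof (intro allI impI, elim conjE)
  fix A x assume A: "A \<subseteq> topspace Z" and x: "x \<in> Z closure_of A"
  have xZ: "x \<in> topspace Z" using x by (simp add: in_closure_of)
  define Y where "Y = subtopology Z (insert x A)"
  have topY: "topspace Y = insert x A" using A xZ by (auto simp: Y_def)
  have limY: "limitin Z s y sequentially" if "limitin Y s y sequentially" for s y
    using that by (simp add: Y_def limitin_subtopology)
  show "\<exists>s. range s \<subseteq> A \<and> limitin Z s x sequentially"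
  proof (cases "x \<in> A")
    case True
    with xZ show ?thesis by (intro exI[of _ "\<lambda>_. x"]) auto
  next
    case False
    have "sigma_separable Y" using assms(2) by (simp add: hereditarily Y_def)
    then obtain B where B: "B \<subseteq> insert x A" "Y sigma_closure_of B = insert x A"
      by (auto simp: sigma_separable_def topY)
    have xB: "x \<in> Y sigma_closure_of B" using B(2) by auto
    \<comment> \<open>Since \<open>B - {x}\<close> is contained in \<open>A\<close>, such a
      \<open>t\<close> is the sequence sought. If \<open>x\<close> is not in \<open>B\<close>, the
      first condition of the \<sigma>-closure already yields it.\<close>
    have "\<exists>t. range t \<subseteq> B - {x} \<and> limitin Y t x sequentially"
    proof (cases "x \<in> B")
      case False
      with xB show ?thesis by (auto simp: sigma_closure_of_def seq_closure_of_def)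
    next
      case True
      \<comment> \<open>A neighbourhood \<open>T\<close> of \<open>x\<close> contains some
        \<open>a\<close> in \<open>A\<close>, and \<open>a\<close> differs from \<open>x\<close>. As
        \<open>a\<close> is a limit of points of \<open>B\<close> and \<open>T - {x}\<close> is
        open, \<open>B - {x}\<close> meets \<open>T\<close>.\<close>
      have "x \<in> Y closure_of (B - {x})"
        unfolding in_closure_of
      proof (intro conjI allI impI)
        show "x \<in> topspace Y" by (simp add: topY)
        fix T assume T: "x \<in> T \<and> openin Y T"
        have "x \<in> Y closure_of A"
          using x by (auto simp: Y_def closure_of_subtopology Int_absorb1 subset_insertI)
        then obtain a where a: "a \<in> A" "a \<in> T" using T by (auto simp: in_closure_of)
        have "a \<in> Y sigma_closure_of B" using a(1) B(2) by auto
        then obtain s where s: "range s \<subseteq> B" "limitin Y s a sequentially"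
          by (auto simp: sigma_closure_of_def seq_closure_of_def)
        have "t1_space Y" using assms(1) by (simp add: Y_def t1_space_subtopology)
        then have "openin Y (T - {x})" using T by (simp add: t1_space_openin_delete_alt)
        moreover have "a \<in> T - {x}" using a False \<open>x \<notin> A\<close> by auto
        ultimately have "eventually (\<lambda>n. s n \<in> T - {x}) sequentially"
          using s(2) unfolding limitin_def by blast
        then obtain n where "s n \<in> T - {x}"
          using eventually_happens'[OF sequentially_bot] by blast
        with s(1) show "\<exists>y. y \<in> B - {x} \<and> y \<in> T" by blast
      qed
      \<comment> \<open>The constant sequence removes exactly the point \<open>x\<close> from
        \<open>B\<close>.\<close>
      then have "range (\<lambda>_::nat. x) \<subseteq> B \<and> limitin Y (\<lambda>_. x) x sequentially \<and>
          x \<in> Y closure_of (B - range (\<lambda>_::nat. x))"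
        using True by (simp add: topY)
      moreover have "\<And>s. range s \<subseteq> B \<and> limitin Y s x sequentially \<and> x \<in> Y closure_of (B - range s) \<Longrightarrow>
          \<exists>t. range t \<subseteq> B - range s \<and> limitin Y t x sequentially"
        using xB by (simp add: sigma_closure_of_def)
      ultimately have "\<exists>t. range t \<subseteq> B - range (\<lambda>_::nat. x) \<and> limitin Y t x sequentially"
        by iprover
      then show ?thesis by simp
    qed
    with B(1) limY show ?thesis by blast
  qed
qed

theorem corollary2p6:
  fixes X :: "'a topology"
  assumes "tychonoff_space X" and "cosmic_space X"
  shows "(strongly_sequentially_separable (Cp X) \<longleftrightarrow> hereditarily F_separable (Cp X)) \<and>
         (hereditarily F_separable (Cp X) \<longleftrightarrow> hereditarily sigma_separable (Cp X)) \<and>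
         (hereditarily sigma_separable (Cp X) \<longleftrightarrow> Frechet_Urysohn_space (Cp X)) \<and>
         (Frechet_Urysohn_space (Cp X) \<longleftrightarrow> gamma_space X)"
proof -
  have separable: "separable_space (subtopology (Cp X) S)" for S
    using assms(2) by (simp add: cosmic_imp_separable_space cosmic_space_subtopology cosmic_space_Cp)
  have "strongly_sequentially_separable (Cp X) \<Longrightarrow> gamma_space X"
    using assms by (rule strongly_sequentially_separable_imp_gamma_space)
  moreover have "gamma_space X \<Longrightarrow> Frechet_Urysohn_space (Cp X)"
    using assms(1) by (simp add: gamma_space_imp_Frechet_Urysohn_Cp tychonoff_space_def)
  moreover have "Frechet_Urysohn_space (Cp X) \<Longrightarrow> hereditarily F_separable (Cp X)"
    using separable
    by (simp add: hereditarily Frechet_Urysohn_separable_imp_F_separable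
        Frechet_Urysohn_space_subtopology)
  moreover have "hereditarily F_separable (Cp X) \<Longrightarrow> hereditarily sigma_separable (Cp X)"
    by (simp add: hereditarily F_separable_imp_sigma_separable)
  moreover have "hereditarily sigma_separable (Cp X) \<Longrightarrow> Frechet_Urysohn_space (Cp X)"
    using t1_space_Cp by (rule hereditarily_sigma_separable_imp_Frechet_Urysohn)
  moreover have "Frechet_Urysohn_space (Cp X) \<Longrightarrow> strongly_sequentially_separable (Cp X)"
    \<comment> \<open>The subspace on \<open>UNIV\<close> is \<open>Cp X\<close> itself.\<close>
    using separable[of UNIV]
    by (simp add: Frechet_Urysohn_separable_imp_strongly_sequentially_separable)
  ultimately show ?thesis by blast
qed

end
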